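(* Let $q$ be an odd prime power with $q\ge5$, let $U$ be a subgroup of $\mathbb{F}_q^*$ of order $n\ge2$ generated by $\alpha$, and let $c\in\mathbb{F}_q^*$, $c\ne1$. Put $a=-1/\alpha$, $b=-ac$, and $\mathbf{O}_n=\{x_1,\ldots,x_n\}$ with $x_i=b\sum_{j=0}^{n-i}(-1/a)^{j+1}$ for $1\le i\le n$. Let $F:\mathbb{F}_q\to\mathbb{F}_q$ be defined by $F(\delta)=(a+1)\delta+b$ for $\delta\notin\mathbf{O}_n$, $F(x_i)=ax_{i-1}+x_i+b$ for $2\le i\le n$, and $F(x_1)=0$. Then $V_F=\mathbb{F}_q\setminus cU$.
   Context: $V_F=\{F(x):x\in\mathbb{F}_q\}$ denotes the value set of $F$, and $cU=\{cu:u\in U\}$. (Here $x_1=0$, $x_n=-b/a$, and $F=f+x$ where $f$ is the permutation with $f=g$ off $\mathbf{O}_n$, $f(x_i)=g(x_{i-1})$ for $i\ge2$, $f(x_1)=g(x_n)=0$, $g(x)=ax+b$; such $F$ form the class $\mathcal{F}_{q,n}$.) *)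

theory Defs
  imports "HOL-Algebra.Multiplicative_Group" "HOL-Number_Theory.Prime_Powers"
begin

end

theory Submission
  imports Defs
begin

text \<open>
  Off the orbit \<open>O\<^sub>n\<close>, \<open>F\<close> agrees with the affine map \<open>L \<delta> = (a + 1) \<delta> + b\<close>, which is a
  bijection because \<open>n \<ge> 2\<close> forces \<open>\<alpha> \<noteq> 1\<close>, i.e. \<open>a + 1 \<noteq> 0\<close>.
  Since \<open>-1/a = \<alpha>\<close> and \<open>b \<alpha> = c\<close>, the orbit consists of the geometric sums
  \<open>x\<^sub>i = c (1 + \<alpha> + \<dots> + \<alpha>\<^bsup>n-i\<^esup>)\<close>, and telescoping gives \<open>L x\<^sub>i = c \<alpha>\<^bsup>n-i\<^esup>\<close>.
  Hence \<open>L\<close> maps the orbit onto \<open>c U\<close>, while \<open>F\<close> maps all of it to \<open>0\<close>, which is not in \<open>c U\<close>.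
\<close>

lemma (in field) inj_on_affine:
  assumes "r \<in> carrier R" "r \<noteq> \<zero>" "s \<in> carrier R"
  shows "inj_on (\<lambda>y. r \<otimes> y \<oplus> s) (carrier R)"
  using assms by (auto intro!: inj_onI simp: m_lcancel)

text \<open>Telescoping: extending the sum by \<open>\<alpha> [^] Suc m\<close> adds
  \<open>c \<otimes> \<alpha> [^] Suc m\<close> and removes
  \<open>c \<otimes> \<alpha> [^] m\<close>. With \<open>a\<close> and \<open>b\<close> substituted,
  the left side is the affine map at the orbit point whose sum ends at \<open>m\<close>.\<close>

lemma (in field) affine_geometric_sum:
  fixes m :: nat
  assumes \<alpha>: "\<alpha> \<in> carrier R" "\<alpha> \<noteq> \<zero>" and c: "c \<in> carrier R"
  shows "(\<ominus> (inv \<alpha>) \<oplus> \<one>) \<otimes> (c \<otimes> (\<Oplus>j\<in>{0..m}. \<alpha> [^] j)) \<oplus> inv \<alpha> \<otimes> c = c \<otimes> \<alpha> [^] m"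
proof -
  have i: "inv \<alpha> \<in> carrier R" using \<alpha> by (simp add: field_Units)
  show ?thesis
  proof (induction m)
    case 0
    show ?case using i c by (simp, algebra)
  next
    case (Suc m)
    define S where "S = (\<Oplus>j\<in>{0..m}. \<alpha> [^] j)"
    define p where "p = \<alpha> [^] m"
    have S: "S \<in> carrier R" and p: "p \<in> carrier R"
      using \<alpha> by (auto simp: S_def p_def intro: finsum_closed)
    have sum: "(\<Oplus>j\<in>{0..Suc m}. \<alpha> [^] j) = p \<otimes> \<alpha> \<oplus> S"
      using \<alpha> by (simp add: S_def p_def atLeast0_atMost_Suc)
    have IH: "(\<ominus> (inv \<alpha>) \<oplus> \<one>) \<otimes> (c \<otimes> S) \<oplus> inv \<alpha> \<otimes> c = c \<otimes> p"
      using Suc by (simp add: S_def p_def)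
    have inv: "inv \<alpha> \<otimes> \<alpha> = \<one>" using \<alpha> by (simp add: field_Units)
    \<comment> \<open>The new top term is split off to expose the induction hypothesis. This is a
      pure ring identity in which \<open>inv \<alpha>\<close> is an opaque element; the product
      \<open>inv \<alpha> \<otimes> \<alpha>\<close> stays visible so that it can be rewritten to 1
      next.\<close>
    have "(\<ominus> (inv \<alpha>) \<oplus> \<one>) \<otimes> (c \<otimes> (p \<otimes> \<alpha> \<oplus> S)) \<oplus> inv \<alpha> \<otimes> c
        = ((\<ominus> (inv \<alpha>) \<oplus> \<one>) \<otimes> (c \<otimes> S) \<oplus> inv \<alpha> \<otimes> c) \<oplus> (c \<otimes> p \<otimes> \<alpha> \<ominus> (inv \<alpha> \<otimes> \<alpha>) \<otimes> (c \<otimes> p))"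
      using i S p c \<alpha> by algebra
    also have "\<dots> = c \<otimes> (p \<otimes> \<alpha>)"
      unfolding IH inv using i S p c \<alpha> by algebra
    finally show ?case using sum by (simp add: p_def)
  qed
qed

theorem theorem11:
  fixes R :: "('a, 'm) ring_scheme" (structure)
    and q n :: nat
    and U O\<^sub>n :: "'a set"
    and \<alpha> c a b :: 'a
    and x :: "nat \<Rightarrow> 'a"
    and F :: "'a \<Rightarrow> 'a"
  assumes "field R" and "finite (carrier R)" and "order R = q"
    and "primepow q" and "odd q" and "q \<ge> 5"
    and "subgroup U (mult_of R)" and "card U = n" and "n \<ge> 2"
    and "\<alpha> \<in> carrier (mult_of R)" and "U = generate (mult_of R) {\<alpha>}"
    and "c \<in> carrier (mult_of R)" and "c \<noteq> \<one>"
    and "a = \<ominus> (inv \<alpha>)" and "b = \<ominus> (a \<otimes> c)"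
    and "\<And>i. i \<in> {1..n} \<Longrightarrow> x i = b \<otimes> (\<Oplus>j\<in>{0..n - i}. (\<ominus> (inv a)) [^] (j + 1))"
    and "O\<^sub>n = x ` {1..n}"
    and "F \<in> carrier R \<rightarrow> carrier R"
    and "\<And>\<delta>. \<delta> \<in> carrier R - O\<^sub>n \<Longrightarrow> F \<delta> = (a \<oplus> \<one>) \<otimes> \<delta> \<oplus> b"
    and "\<And>i. i \<in> {2..n} \<Longrightarrow> F (x i) = a \<otimes> x (i - 1) \<oplus> x i \<oplus> b"
    and "F (x 1) = \<zero>"
  shows "F ` carrier R = carrier R - {c \<otimes> u | u. u \<in> U}"
proof -
  interpret field R by fact
  interpret M: group "mult_of R" by (rule field_mult_group)
  have \<alpha>: "\<alpha> \<in> carrier R" "\<alpha> \<noteq> \<zero>" and c: "c \<in> carrier R" "c \<noteq> \<zero>"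
    using assms(10,12) by auto
  have i: "inv \<alpha> \<in> carrier R" and inv: "inv \<alpha> \<otimes> \<alpha> = \<one>"
    using \<alpha> by (simp_all add: field_Units)
  have a: "a \<in> carrier R" and b: "b \<in> carrier R" and b_eq: "b = inv \<alpha> \<otimes> c"
    using assms(14,15) i c by (auto simp: l_minus)
  have "a \<otimes> \<ominus> \<alpha> = \<one>"
    using inv i \<alpha> unfolding assms(14) by algebra
  then have inv_a: "\<ominus> (inv a) = \<alpha>"
    using \<alpha> a by (metis comm_inv_char a_inv_closed minus_minus)
  define L where "L y = (a \<oplus> \<one>) \<otimes> y \<oplus> b" for y

  have "\<alpha> \<noteq> \<one>"
  proof
    assume "\<alpha> = \<one>"
    then have "U = {\<one>}"
      using M.generate_one assms(11) by simp
    with assms(8,9) show False by simp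
  qed
  have "a \<oplus> \<one> \<noteq> \<zero>"
  proof
    assume "a \<oplus> \<one> = \<zero>"
    then have "inv \<alpha> = \<one>"
      using i a assms(14) minus_equality[of a \<one>] by (metis minus_minus one_closed)
    with inv \<alpha> \<open>\<alpha> \<noteq> \<one>\<close> show False by simp
  qed
  with a b have inj: "inj_on L (carrier R)"
    unfolding L_def by (intro inj_on_affine) auto
  have "L ` carrier R \<subseteq> carrier R"
    using a b by (auto simp: L_def)
  with inj assms(2) have surj: "L ` carrier R = carrier R"
    by (simp add: endo_inj_surj)

  have x_eq: "x i = c \<otimes> (\<Oplus>j\<in>{0..n - i}. \<alpha> [^] j)" if "i \<in> {1..n}" for i
  proof -
    \<comment> \<open>The exponents \<open>j + 1\<close> leave a common factor \<alpha>, which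
      cancels the \<open>inv \<alpha>\<close> contained in \<open>b\<close>.\<close>
    have "(\<Oplus>j\<in>{0..n - i}. \<alpha> [^] (j + 1)) = (\<Oplus>j\<in>{0..n - i}. \<alpha> [^] j) \<otimes> \<alpha>"
      using \<alpha> by (subst finsum_ldistr) (auto)
    moreover have "(\<Oplus>j\<in>{0..n - i}. \<alpha> [^] j) \<in> carrier R"
      using \<alpha> by (auto intro: finsum_closed)
    moreover have "inv \<alpha> \<otimes> c \<otimes> (s \<otimes> \<alpha>) = (inv \<alpha> \<otimes> \<alpha>) \<otimes> (c \<otimes> s)" if "s \<in> carrier R" for s
      using that i c \<alpha> by algebra
    ultimately show ?thesis
      using assms(16)[OF that] inv_a b_eq inv c by simp
  qed
  then have x: "x i \<in> carrier R" if "i \<in> {1..n}" for i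
    using that c \<alpha> by (auto intro!: finsum_closed)
  have Lx: "L (x i) = c \<otimes> \<alpha> [^] (n - i)" if "i \<in> {1..n}" for i
    using affine_geometric_sum[OF \<alpha> c(1)] x_eq[OF that] assms(14) b_eq by (simp add: L_def)

  \<comment> \<open>For \<open>i\<close> at least 2, going back one index adds the term
    \<open>c \<otimes> \<alpha> [^] (n - i + 1)\<close> to the orbit point. Multiplied by
    \<open>a\<close>, it becomes the negative of \<open>L (x i)\<close>, so the two cancel.\<close>
  have Fx: "F (x i) = \<zero>" if "i \<in> {1..n}" for i
  proof (cases "i = 1")
    case False
    with that have i2: "i \<in> {2..n}" by auto
    then have n_i: "n - (i - 1) = Suc (n - i)" and i1: "i - 1 \<in> {1..n}" by auto
    define p where "p = \<alpha> [^] (n - i)"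
    have p: "p \<in> carrier R" using \<alpha> by (simp add: p_def)
    define S where "S = (\<Oplus>j\<in>{0..n - i}. \<alpha> [^] j)"
    have S: "S \<in> carrier R" using \<alpha> by (auto simp: S_def intro: finsum_closed)
    have "x (i - 1) = c \<otimes> (\<Oplus>j\<in>{0..Suc (n - i)}. \<alpha> [^] j)"
      using x_eq[OF i1] unfolding n_i .
    also have "\<dots> = c \<otimes> (p \<otimes> \<alpha> \<oplus> S)"
      using \<alpha> by (simp add: S_def p_def atLeast0_atMost_Suc)
    also have "\<dots> = x i \<oplus> c \<otimes> (p \<otimes> \<alpha>)"
      using x_eq[OF that] c p S \<alpha> by (simp add: S_def[symmetric], algebra)
    finally have "F (x i) = a \<otimes> (x i \<oplus> c \<otimes> (p \<otimes> \<alpha>)) \<oplus> x i \<oplus> b"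
      using assms(20)[OF i2] by simp
    also have "\<dots> = L (x i) \<ominus> (inv \<alpha> \<otimes> \<alpha>) \<otimes> (c \<otimes> p)"
      using i \<alpha> b p c x[OF that] unfolding L_def assms(14) by algebra
    also have "\<dots> = \<zero>"
      unfolding Lx[OF that] inv p_def[symmetric] using c p by algebra
    finally show ?thesis .
  qed (use assms(21) in simp)

  have "finite (carrier (mult_of R))" using assms(2) by simp
  \<comment> \<open>The order of \<alpha> is the size of the subgroup it generates, namely
    \<open>n\<close>, so the exponents below \<open>n\<close> suffice.\<close>
  then have "U = {\<alpha> [^] k | k. k \<in> {0..n - 1}}"
    using M.ord_elems[of \<alpha>] M.generate_pow_on_finite_carrier[of \<alpha>] M.generate_pow_card[of \<alpha>]
      assms(8,10,11) by (simp add: nat_pow_mult_of)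
  also have "\<dots> = (\<lambda>i. \<alpha> [^] (n - i)) ` {1..n}"
  proof -
    have "(\<lambda>i. n - i) ` {1..n} = {0..n - 1}"
    proof (intro equalityI subsetI)
      fix k assume "k \<in> {0..n - 1}"
      \<comment> \<open>Truncated subtraction is harmless here: \<open>n\<close> is positive, so
        \<open>k\<close> is less than \<open>n\<close>.\<close>
      then have "k = n - (n - k)" "n - k \<in> {1..n}" using assms(9) by auto
      then show "k \<in> (\<lambda>i. n - i) ` {1..n}" by (rule image_eqI)
    qed auto
    then have "(\<lambda>k. \<alpha> [^] k) ` {0..n - 1} = (\<lambda>k. \<alpha> [^] k) ` (\<lambda>i. n - i) ` {1..n}"
      by simp
    then show ?thesis unfolding image_image Setcompr_eq_image .
  qed
  finally have U: "U = (\<lambda>i. \<alpha> [^] (n - i)) ` {1..n}" .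
  have LO: "L ` O\<^sub>n = {c \<otimes> u | u. u \<in> U}"
    using Lx unfolding assms(17) U by (force simp: image_iff)
  have O_sub: "O\<^sub>n \<subseteq> carrier R"
    using x assms(17) by auto
  have "F ` carrier R = F ` O\<^sub>n \<union> F ` (carrier R - O\<^sub>n)"
    using O_sub by blast
  \<comment> \<open>The orbit is nonempty, so 0 really is attained.\<close>
  also have "F ` O\<^sub>n = {\<zero>}"
    using Fx assms(9) unfolding assms(17) by force
  also have "F ` (carrier R - O\<^sub>n) = L ` (carrier R - O\<^sub>n)"
    using assms(19) by (auto simp: L_def)
  \<comment> \<open>Injectivity of \<open>L\<close> lets the image commute with the set
    difference.\<close>
  also have "\<dots> = carrier R - {c \<otimes> u | u. u \<in> U}"
    using inj_on_image_set_diff[OF inj _ O_sub, of "carrier R"] surj LO by simp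
  \<comment> \<open>As \<open>c\<close> and all elements of \<open>U\<close> are nonzero, 0 is
    already a value of \<open>L\<close> off the orbit.\<close>
  also have "{\<zero>} \<union> \<dots> = \<dots>"
  proof -
    have "c \<otimes> u \<noteq> \<zero>" if "u \<in> U" for u
      using subgroup.mem_carrier[OF assms(7) that] c by (simp add: integral_iff)
    then have "\<zero> \<notin> {c \<otimes> u | u. u \<in> U}" by fastforce
    with zero_closed have "\<zero> \<in> carrier R - {c \<otimes> u | u. u \<in> U}" by (rule DiffI)
    then show ?thesis by (simp only: insert_absorb insert_is_Un[symmetric])
  qed
  finally show ?thesis .
qed

end
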